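(* Let $G$ be a group acting regularly on a set. Then $G$ is join-coherent in this action if and only if $G$ is locally cyclic.
   Context: For a group $G$ acting on a set $\Omega$ and $g\in G$, $\pi(g)$ denotes the partition of $\Omega$ into the orbits of $g$, and $\pi(G)=\{\pi(g)\mid g\in G\}$. Partitions are ordered by refinement, and $\vee$ denotes the supremum (join) of two partitions. $G$ is join-coherent if $\pi(G)$ is closed under $\vee$. An action is regular if it is transitive and all point stabilizers are trivial. A group is locally cyclic if any pair of its elements generates a cyclic subgroup. Groups and sets may be infinite. *)

theory Defs
  imports
    "HOL-Algebra.Group_Action"
    "HOL-Algebra.Elementary_Groups"
    "HOL-Algebra.Lattice"
    "HOL-Library.Disjoint_Sets"
begin

text \<open>
  Nonemptiness of the set has to be stated separately: the library's \<^locale>\<open>transitive_action\<close>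
  only asks that any two points be related by a group element, and so every group acts
  transitively (and with trivial stabilizers) on the empty set. Transitivity in the sense of
  having exactly one orbit excludes this case.
\<close>

locale regular_action = transitive_action +
  assumes nonempty: "E \<noteq> {}"
    and trivial_stabilizers: "x \<in> E \<Longrightarrow> stabilizer G \<phi> x = {\<one>\<^bsub>G\<^esub>}"

text \<open>
  The orbits of a single element are those of the cyclic subgroup it generates.
\<close>

definition orbit_partition_of ::
    "('a, 'c) monoid_scheme \<Rightarrow> 'b set \<Rightarrow> ('a \<Rightarrow> 'b \<Rightarrow> 'b) \<Rightarrow> 'a \<Rightarrow> 'b set set"
  where "orbit_partition_of G E \<phi> g = orbits (subgroup_generated G {g}) E \<phi>"

definition orbit_partitions ::
    "('a, 'c) monoid_scheme \<Rightarrow> 'b set \<Rightarrow> ('a \<Rightarrow> 'b \<Rightarrow> 'b) \<Rightarrow> 'b set set set"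
  where "orbit_partitions G E \<phi> = orbit_partition_of G E \<phi> ` carrier G"

text \<open>
  All partitions of a set, with finer partitions below coarser ones.
\<close>

definition partition_order :: "'b set \<Rightarrow> 'b set set gorder"
  where "partition_order E = \<lparr>carrier = {P. partition_on E P}, eq = (=), le = refines E\<rparr>"

definition join_coherent ::
    "('a, 'c) monoid_scheme \<Rightarrow> 'b set \<Rightarrow> ('a \<Rightarrow> 'b \<Rightarrow> 'b) \<Rightarrow> bool"
  where "join_coherent G E \<phi> \<longleftrightarrow>
    (\<forall>P \<in> orbit_partitions G E \<phi>. \<forall>Q \<in> orbit_partitions G E \<phi>.
      P \<squnion>\<^bsub>partition_order E\<^esub> Q \<in> orbit_partitions G E \<phi>)"

definition locally_cyclic_group :: "('a, 'c) monoid_scheme \<Rightarrow> bool"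
  where "locally_cyclic_group G \<longleftrightarrow>
    (\<forall>x \<in> carrier G. \<forall>y \<in> carrier G. cyclic_group (subgroup_generated G {x, y}))"

text \<open>
  \<^const>\<open>join\<close> is defined by a choice operator, so it denotes the supremum only where one exists;
  \<^const>\<open>orbits\<close> is likewise only a set of sets. The following two facts show that both are
  meaningful as used above.
\<close>

lemma upper_semilattice_partition_order: "upper_semilattice (partition_order E)"
proof -
  interpret partial_order "partition_order E"
    by unfold_locales
      (auto simp: partition_order_def intro: refines_refl refines_trans dest: refines_asym)
  show ?thesis
  proof
    fix P Q
    assume P: "P \<in> carrier (partition_order E)" and Q: "Q \<in> carrier (partition_order E)"
    define \<U> where "\<U> = Upper (partition_order E) {P, Q}"
    define r where "r = {(x, y) \<in> E \<times> E. \<forall>U\<in>\<U>. \<exists>u\<in>U. x \<in> u \<and> y \<in> u}"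
    have \<U>: "U \<in> \<U> \<longleftrightarrow> refines E P U \<and> refines E Q U" for U
      using P Q by (auto simp: \<U>_def Upper_def partition_order_def refines_def)
    have part: "partition_on E U" if "U \<in> \<U>" for U
      using that by (simp add: \<U> refines_def)
    have "equiv E r"
    proof (rule equivI)
      show "r \<subseteq> E \<times> E" by (auto simp: r_def)
      show "refl_on E r"
        using part by (auto simp: refl_on_def r_def partition_on_def)
      show "sym r" by (auto simp: r_def intro!: symI)
      show "trans r"
      proof (rule transI)
        fix x y z assume xy: "(x, y) \<in> r" and yz: "(y, z) \<in> r"
        have "\<exists>u\<in>U. x \<in> u \<and> z \<in> u" if U: "U \<in> \<U>" for U
        proof -
          obtain u v where uv: "u \<in> U" "x \<in> u" "y \<in> u" "v \<in> U" "y \<in> v" "z \<in> v"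
            using xy yz U unfolding r_def by blast
          then have "u = v"
            using partition_onD2[OF part[OF U]] by (auto simp: disjoint_def)
          with uv show ?thesis by blast
        qed
        with xy yz show "(x, z) \<in> r" by (auto simp: r_def)
      qed
    qed
    then have S: "partition_on E (E // r)" by (rule partition_on_quotient)
    have above: "refines E R (E // r)"
      if R: "partition_on E R" and le: "\<And>U. U \<in> \<U> \<Longrightarrow> refines E R U" for R
    proof -
      have "\<exists>Y\<in>E // r. X \<subseteq> Y" if X: "X \<in> R" for X
      proof -
        obtain x where x: "x \<in> X" using partition_onD3[OF R] X by fastforce
        have XE: "X \<subseteq> E" using partition_onD1[OF R] X by blast
        have "X \<subseteq> r `` {x}"
        proof
          fix y assume y: "y \<in> X"
          have "\<exists>u\<in>U. x \<in> u \<and> y \<in> u" if "U \<in> \<U>" for U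
            using le[OF that] X x y unfolding refines_def by blast
          then show "y \<in> r `` {x}" using x y XE by (auto simp: r_def)
        qed
        moreover have "r `` {x} \<in> E // r" using x XE by (auto intro: quotientI)
        ultimately show ?thesis by blast
      qed
      with R S show ?thesis by (simp add: refines_def)
    qed
    have below: "refines E (E // r) U" if U: "U \<in> \<U>" for U
    proof -
      have "\<exists>Y\<in>U. X \<subseteq> Y" if X: "X \<in> E // r" for X
      proof -
        obtain x where x: "x \<in> E" "X = r `` {x}" using X by (auto elim: quotientE)
        obtain u where u: "u \<in> U" "x \<in> u"
          using partition_onD1[OF part[OF U]] x by blast
        have "y \<in> u" if xy: "(x, y) \<in> r" for y
        proof -
          obtain v where v: "v \<in> U" "x \<in> v" "y \<in> v" using xy U unfolding r_def by blast
          then have "u = v"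
            using u partition_onD2[OF part[OF U]] by (auto simp: disjoint_def)
          with v show ?thesis by blast
        qed
        with x u show ?thesis by blast
      qed
      with part[OF U] S show ?thesis by (simp add: refines_def)
    qed
    have "least (partition_order E) (E // r) (Upper (partition_order E) {P, Q})"
    proof (rule least_UpperI)
      show "R \<sqsubseteq>\<^bsub>partition_order E\<^esub> E // r" if "R \<in> {P, Q}" for R
        using that P Q above \<U> by (auto simp: partition_order_def)
      show "E // r \<sqsubseteq>\<^bsub>partition_order E\<^esub> U" if "U \<in> Upper (partition_order E) {P, Q}" for U
        using that below by (simp add: \<U>_def partition_order_def)
    qed (use P Q S in \<open>auto simp: partition_order_def\<close>)
    then show "\<exists>s. least (partition_order E) s (Upper (partition_order E) {P, Q})" ..
  qed
qed

lemma (in group_action) partition_on_orbit_partition_of: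
  assumes "g \<in> carrier G"
  shows "partition_on E (orbit_partition_of G E \<phi> g)"
proof -
  interpret group_hom G "BijGroup E" \<phi> by (rule group_hom)
  interpret H: group_action "subgroup_generated G {g}" E \<phi>
  proof (rule group_action.intro)
    show "group_hom (subgroup_generated G {g}) (BijGroup E) \<phi>"
      unfolding group_hom_def group_hom_axioms_def
      using homh G.carrier_subgroup_generated_subset[of "{g}"]
      by (auto simp: hom_def group_BijGroup Pi_iff subset_iff)
  qed
  show ?thesis
    unfolding orbit_partition_of_def
  proof (rule partition_onI)
    show "\<Union> (orbits (subgroup_generated G {g}) E \<phi>) = E"
      by (rule H.orbits_coverture)
    show "disjnt p q"
      if "p \<in> orbits (subgroup_generated G {g}) E \<phi>"
        "q \<in> orbits (subgroup_generated G {g}) E \<phi>" "p \<noteq> q" for p q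
      using H.disjoint_union that by (auto simp: disjnt_def)
    show "{} \<notin> orbits (subgroup_generated G {g}) E \<phi>"
      using H.orbit_refl by (auto simp: orbits_def)
  qed
qed

end

theory Submission
  imports Defs
begin

text \<open>
  A partition is coarser than the orbit partition of a group generated by a set exactly when every
  generator preserves each of its blocks. So the join of the orbit partitions of two generated
  subgroups is the orbit partition of the subgroup they generate together. In a regular action a
  subgroup can be recovered from its orbit partition, as the elements carrying a base point into
  its own block. Hence the join of the partitions of \<open>g\<close> and \<open>h\<close> is that of a single element \<open>k\<close>
  if and only if \<open>g\<close> and \<open>h\<close> generate the same subgroup as \<open>k\<close>.
\<close>

lemma partition_on_block_eq:
  assumes "partition_on A P" "X \<in> P" "Y \<in> P" "x \<in> X" "x \<in> Y"
  shows "X = Y"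
  using assms partition_onD2 by (fastforce simp: disjoint_def)

text \<open>Least upper bounds are unique, so exhibiting one pins down the value of the choice
  operator behind \<open>join\<close>.\<close>

lemma upper_semilattice_join_eqI:
  assumes "upper_semilattice L" "x \<in> carrier L" "y \<in> carrier L" "least L s (Upper L {x, y})"
  shows "x \<squnion>\<^bsub>L\<^esub> y = s"
proof -
  interpret upper_semilattice L by fact
  show ?thesis
    by (rule joinI) (use assms least_unique in auto)
qed

text \<open>Powers agree in \<open>G\<close> and in the subgroup, and \<open>k\<close> lies in the
  subgroup it generates. Hence a generator may be sought in all of \<open>G\<close>, which matches
  the quantifier in \<open>orbit_partitions\<close>.\<close>

lemma (in group) cyclic_subgroup_generated_iff:
  "cyclic_group (subgroup_generated G S) \<longleftrightarrow>
    (\<exists>k \<in> carrier G. carrier (subgroup_generated G S) = carrier (subgroup_generated G {k}))"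
proof -
  have "cyclic_group (subgroup_generated G S) \<longleftrightarrow>
      (\<exists>k \<in> carrier (subgroup_generated G S).
        carrier (subgroup_generated G S) = carrier (subgroup_generated G {k}))"
    using carrier_subgroup_generated_subset[of S]
    by (auto simp: group.cyclic_group int_pow_subgroup_generated
        carrier_subgroup_generated_by_singleton subset_iff)
  moreover have "k \<in> carrier (subgroup_generated G {k})" if "k \<in> carrier G" for k
    using that subgroup_generated_subset_carrier_subset[of "{k}"] by simp
  ultimately show ?thesis
    using carrier_subgroup_generated_subset[of S] by blast
qed

lemma orbit_in_orbits: "x \<in> E \<Longrightarrow> orbit G \<phi> x \<in> orbits G E \<phi>"
  by (auto simp: orbits_def)

context group_action
begin

lemma group: "group G"
  using group_hom by (rule group_hom.axioms)

lemma group_action_subgroup_generated: "group_action (subgroup_generated G S) E \<phi>"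
proof -
  interpret group_hom G "BijGroup E" \<phi> by (rule group_hom)
  show ?thesis
    by (simp add: group_action_def group_hom_def group_hom_axioms_def group_BijGroup
        G.hom_from_subgroup_generated)
qed

text \<open>Proved for an arbitrary action, so that it transfers to the restricted action of any
  generated subgroup.\<close>

lemma partition_on_orbits: "partition_on E (orbits G E \<phi>)"
proof (rule partition_onI)
  show "\<Union> (orbits G E \<phi>) = E"
    by (rule orbits_coverture)
  show "disjnt p q" if "p \<in> orbits G E \<phi>" "q \<in> orbits G E \<phi>" "p \<noteq> q" for p q
    using disjoint_union that by (auto simp: disjnt_def)
  show "{} \<notin> orbits G E \<phi>"
    using orbit_refl by (auto simp: orbits_def)
qed

lemmas partition_on_orbits_subgroup_generated =
  group_action.partition_on_orbits[OF group_action_subgroup_generated]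

text \<open>A preimage of a point of \<open>X\<close> lies in some block, which is mapped into
  itself and so must be \<open>X\<close>. Inclusion for \<open>X\<close> alone would not suffice: an
  infinite block can be mapped properly into itself.\<close>

lemma preserves_block_imp_image_eq:
  assumes P: "partition_on E P" and g: "g \<in> carrier G" and X: "X \<in> P"
    and pres: "\<And>Y. Y \<in> P \<Longrightarrow> \<phi> g ` Y \<subseteq> Y"
  shows "\<phi> g ` X = X"
proof
  show "X \<subseteq> \<phi> g ` X"
  proof
    fix x assume x: "x \<in> X"
    then have "x \<in> E" using partition_onD1[OF P] X by blast
    then obtain y where y: "y \<in> E" "\<phi> g y = x" using bij_prop1[OF g] by blast
    then obtain Y where Y: "Y \<in> P" "y \<in> Y" using partition_onD1[OF P] by blast
    with y pres have "x \<in> Y" by blast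
    with P X Y x have "Y = X" by (intro partition_on_block_eq)
    with y Y show "x \<in> \<phi> g ` X" by blast
  qed
qed (use pres X in blast)

text \<open>This extends invariance of the blocks from generators to the subgroup they generate.
  Asking for equality rather than inclusion makes closure under inverses immediate.\<close>

lemma subgroup_block_stabilizer:
  assumes P: "partition_on E P"
  shows "subgroup {g \<in> carrier G. \<forall>X\<in>P. \<phi> g ` X = X} G"
proof -
  interpret group G by (rule group)
  have XE: "x \<in> E" if "X \<in> P" "x \<in> X" for X x
    using partition_onD1[OF P] that by blast
  show ?thesis
  proof (rule subgroupI)
    \<comment> \<open>\<open>\<phi> \<one>\<close> is the identity restricted to \<open>E\<close>,
      so it matters that blocks lie in \<open>E\<close>.\<close>
    have "\<phi> \<one> ` X = X" if "X \<in> P" for X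
      using XE[OF that] by (simp flip: id_eq_one cong: image_cong_simp)
    then show "{g \<in> carrier G. \<forall>X\<in>P. \<phi> g ` X = X} \<noteq> {}" by blast
  next
    fix g assume g: "g \<in> {g \<in> carrier G. \<forall>X\<in>P. \<phi> g ` X = X}"
    have "\<phi> (inv g) ` X = X" if X: "X \<in> P" for X
    proof -
      have "\<phi> (inv g) (\<phi> g x) = x" if "x \<in> X" for x
        using g orbit_sym_aux[OF _ XE[OF X that] refl] by blast
      then have "\<phi> (inv g) ` (\<phi> g ` X) = X"
        by (simp add: image_image cong: image_cong_simp)
      with g X show ?thesis by simp
    qed
    with g show "inv g \<in> {g \<in> carrier G. \<forall>X\<in>P. \<phi> g ` X = X}" by simp
  next
    fix g h assume g: "g \<in> {g \<in> carrier G. \<forall>X\<in>P. \<phi> g ` X = X}"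
      and h: "h \<in> {g \<in> carrier G. \<forall>X\<in>P. \<phi> g ` X = X}"
    have "\<phi> (g \<otimes> h) ` X = X" if X: "X \<in> P" for X
    proof -
      have "\<phi> (g \<otimes> h) ` X = \<phi> g ` (\<phi> h ` X)"
        unfolding image_image
        by (rule image_cong) (use g h XE[OF X] composition_rule in auto)
      with g h X show ?thesis by simp
    qed
    with g h show "g \<otimes> h \<in> {g \<in> carrier G. \<forall>X\<in>P. \<phi> g ` X = X}" by simp
  qed blast
qed

text \<open>Forwards, \<open>x\<close> and \<open>\<phi> g x\<close> share an orbit and hence a
  block. Backwards, the block stabilizer is a subgroup containing \<open>S\<close>, so it contains
  the generated subgroup and no orbit leaves its block.\<close>

lemma refines_orbits_subgroup_generated_iff:
  assumes P: "partition_on E P" and S: "S \<subseteq> carrier G"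
  shows "refines E (orbits (subgroup_generated G S) E \<phi>) P \<longleftrightarrow> (\<forall>g\<in>S. \<forall>X\<in>P. \<phi> g ` X \<subseteq> X)"
    (is "?refines \<longleftrightarrow> ?preserves")
proof
  interpret group G by (rule group)
  interpret S: group_action "subgroup_generated G S" E \<phi>
    by (rule group_action_subgroup_generated)
  show ?preserves if ?refines
  proof (intro ballI subsetI)
    fix g X y assume g: "g \<in> S" and X: "X \<in> P" and "y \<in> \<phi> g ` X"
    then obtain x where x: "x \<in> X" "y = \<phi> g x" by blast
    have xE: "x \<in> E" using partition_onD1[OF P] X x by blast
    from \<open>?refines\<close> orbit_in_orbits[OF xE]
    obtain Y where Y: "Y \<in> P" "orbit (subgroup_generated G S) \<phi> x \<subseteq> Y"
      unfolding refines_def by blast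
    have "x \<in> Y" using Y S.orbit_refl[OF xE] by blast
    with P X Y x have "Y = X" by (intro partition_on_block_eq)
    moreover have "y \<in> orbit (subgroup_generated G S) \<phi> x"
      using g x subgroup_generated_subset_carrier_subset[OF S] by (auto simp: orbit_def)
    ultimately show "y \<in> X" using Y by blast
  qed
  show ?refines if ?preserves
  proof -
    have "\<phi> g ` X = X" if "g \<in> S" "X \<in> P" for g X
      using \<open>?preserves\<close> S that by (intro preserves_block_imp_image_eq[OF P]) auto
    with S have "S \<subseteq> {g \<in> carrier G. \<forall>X\<in>P. \<phi> g ` X = X}"
      by (simp add: subset_iff)
    then have K: "carrier (subgroup_generated G S) \<subseteq> {g \<in> carrier G. \<forall>X\<in>P. \<phi> g ` X = X}"
      by (intro subgroup_generated_minimal subgroup_block_stabilizer[OF P])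
    have "\<exists>Y\<in>P. orbit (subgroup_generated G S) \<phi> x \<subseteq> Y" if "x \<in> E" for x
    proof -
      obtain Y where "Y \<in> P" "x \<in> Y" using partition_onD1[OF P] \<open>x \<in> E\<close> by blast
      with K have "orbit (subgroup_generated G S) \<phi> x \<subseteq> Y" by (auto simp: orbit_def)
      with \<open>Y \<in> P\<close> show ?thesis by blast
    qed
    then show ?thesis
      using P S.partition_on_orbits by (auto simp: refines_def orbits_def)
  qed
qed

lemma join_orbits_subgroup_generated:
  assumes S: "S \<subseteq> carrier G" and T: "T \<subseteq> carrier G"
  shows "orbits (subgroup_generated G S) E \<phi> \<squnion>\<^bsub>partition_order E\<^esub> orbits (subgroup_generated G T) E \<phi>
    = orbits (subgroup_generated G (S \<union> T)) E \<phi>"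
proof -
  \<comment> \<open>The criterion is a condition on each generator separately, so over a union it
    splits into a conjunction.\<close>
  have iff: "refines E (orbits (subgroup_generated G (S \<union> T)) E \<phi>) P \<longleftrightarrow>
      refines E (orbits (subgroup_generated G S) E \<phi>) P \<and>
      refines E (orbits (subgroup_generated G T) E \<phi>) P" if "partition_on E P" for P
    using that S T by (simp add: refines_orbits_subgroup_generated_iff ball_Un)
  show ?thesis
  proof (rule upper_semilattice_join_eqI[OF upper_semilattice_partition_order])
    show "least (partition_order E) (orbits (subgroup_generated G (S \<union> T)) E \<phi>)
      (Upper (partition_order E)
        {orbits (subgroup_generated G S) E \<phi>, orbits (subgroup_generated G T) E \<phi>})"
      \<comment> \<open>The general equivalence gives leastness; its instance at the candidate
        itself, with reflexivity, gives the upper bound.\<close>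
      using iff partition_on_orbits_subgroup_generated
        iff[OF partition_on_orbits_subgroup_generated[of "S \<union> T"]]
      by (auto simp: least_def Upper_def partition_order_def refines_refl)
  qed (simp_all add: partition_order_def partition_on_orbits_subgroup_generated)
qed

end

context regular_action
begin

text \<open>The element \<open>inv h \<otimes> g\<close> fixes \<open>x\<close>, and stabilizers are
  trivial.\<close>

lemma action_cancel:
  assumes x: "x \<in> E" and g: "g \<in> carrier G" and h: "h \<in> carrier G" and eq: "\<phi> g x = \<phi> h x"
  shows "g = h"
proof -
  interpret group G by (rule group)
  have "\<phi> (inv h \<otimes> g) x = x"
    using composition_rule[of x "inv h" g] orbit_sym_aux[OF h x] x g h eq by simp
  with x g h have "inv h \<otimes> g \<in> stabilizer G \<phi> x" by (simp add: stabilizer_def)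
  with trivial_stabilizers[OF x] have "inv h \<otimes> g = \<one>" by simp
  with g h show ?thesis by (metis inv_closed inv_equality inv_inv)
qed

lemma subset_if_orbits_eq:
  assumes eq: "orbits (subgroup_generated G S) E \<phi> = orbits (subgroup_generated G T) E \<phi>"
  shows "carrier (subgroup_generated G S) \<subseteq> carrier (subgroup_generated G T)"
proof
  fix g assume g: "g \<in> carrier (subgroup_generated G S)"
  interpret group G by (rule group)
  interpret S: group_action "subgroup_generated G S" E \<phi>
    by (rule group_action_subgroup_generated)
  interpret T: group_action "subgroup_generated G T" E \<phi>
    by (rule group_action_subgroup_generated)
  \<comment> \<open>Any base point will do, but there must be one: on the empty set all subgroups
    have the same orbit partition.\<close>
  obtain x where x: "x \<in> E" using nonempty by blast
  \<comment> \<open>By \<open>eq\<close> both orbits are blocks of one partition, and they share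
    \<open>x\<close>.\<close>
  have "orbit (subgroup_generated G S) \<phi> x = orbit (subgroup_generated G T) \<phi> x"
  proof (rule partition_on_block_eq[OF T.partition_on_orbits])
    show "orbit (subgroup_generated G S) \<phi> x \<in> orbits (subgroup_generated G T) E \<phi>"
      using orbit_in_orbits[OF x] by (simp flip: eq)
  qed (use x S.orbit_refl T.orbit_refl orbit_in_orbits in auto)
  moreover have "\<phi> g x \<in> orbit (subgroup_generated G S) \<phi> x"
    using g by (auto simp: orbit_def)
  ultimately obtain t where t: "t \<in> carrier (subgroup_generated G T)" "\<phi> g x = \<phi> t x"
    by (auto simp: orbit_def)
  \<comment> \<open>Here freeness of the action recovers the group element from the image of the
    base point.\<close>
  have "g = t"
    using action_cancel[OF x _ _ t(2)] g t(1) carrier_subgroup_generated_subset by blast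
  with t show "g \<in> carrier (subgroup_generated G T)" by simp
qed

lemma orbits_eq_iff:
  "orbits (subgroup_generated G S) E \<phi> = orbits (subgroup_generated G T) E \<phi> \<longleftrightarrow>
    carrier (subgroup_generated G S) = carrier (subgroup_generated G T)"
proof
  assume "carrier (subgroup_generated G S) = carrier (subgroup_generated G T)"
  then show "orbits (subgroup_generated G S) E \<phi> = orbits (subgroup_generated G T) E \<phi>"
    by (simp add: orbits_def orbit_def)
qed (simp add: subset_antisym subset_if_orbits_eq)

lemma join_coherent_iff_locally_cyclic: "join_coherent G E \<phi> \<longleftrightarrow> locally_cyclic_group G"
proof -
  interpret group G by (rule group)
  \<comment> \<open>The equivalence already holds for each pair \<open>g\<close>, \<open>h\<close>:
    both sides say that some \<open>k\<close> generates the same subgroup as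
    \<open>{g, h}\<close>.\<close>
  have "orbit_partition_of G E \<phi> g \<squnion>\<^bsub>partition_order E\<^esub> orbit_partition_of G E \<phi> h
        \<in> orbit_partitions G E \<phi> \<longleftrightarrow> cyclic_group (subgroup_generated G {g, h})"
    if "g \<in> carrier G" "h \<in> carrier G" for g h
    using that join_orbits_subgroup_generated[of "{g}" "{h}"]
    by (simp add: insert_commute[of h g] orbit_partition_of_def orbit_partitions_def image_iff orbits_eq_iff
        cyclic_subgroup_generated_iff)
  then show ?thesis
    by (simp add: join_coherent_def locally_cyclic_group_def orbit_partitions_def)
qed

end

theorem proposition3p3:
  fixes G :: "('a, 'c) monoid_scheme"
    and \<Omega> :: "'b set"
    and \<phi> :: "'a \<Rightarrow> 'b \<Rightarrow> 'b"
  assumes "regular_action G \<Omega> \<phi>"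
  shows "join_coherent G \<Omega> \<phi> \<longleftrightarrow> locally_cyclic_group G"
  using assms by (rule regular_action.join_coherent_iff_locally_cyclic)

end
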